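(* Let $r\ge2$ be an integer and let $f:\mathbb{R}^n\times\mathbb{R}^m\to\mathbb{R}^n$ be a continuous mapping with $f(0,0)=0$. Suppose that there exists a continuous function $k:\mathbb{R}^n\to\mathbb{R}^m$ with $k(0)=0$ such that $0\in\mathbb{R}^n$ is globally asymptotically stable for the system $x(t+1)=f(x(t),k(x(t)))$. Let a continuous, positive definite and radially unbounded function $V:\mathbb{R}^n\to\mathbb{R}_+$ and a constant $\lambda\in[0,1)$ be such that $$V(f(x,k(x)))\le\lambda V(x)\quad\text{for all }x\in\mathbb{R}^n .$$ Let $z_i$ and $F_i$ be the extended vectors and predictor maps defined from $f$ in the context. Then the following hold: (i) $0\in\mathbb{R}^n\times\mathbb{R}^{rm}$ is globally asymptotically stable for the closed-loop system $$x(t+1)=f(x(t),y_1(t)),\qquad y_i(t+1)=y_{i+1}(t)\ (i=1,\dots,r-1),\qquad y_r(t+1)=k(F_r(z_r(t))),$$ where $x(t)\in\mathbb{R}^n$, $y_i(t)\in\mathbb{R}^m$ $(i=1,\dots,r)$ and $z_r(t)=(x(t),y_1(t),\dots,y_r(t))$. (ii) For all $a_i\in K_\infty$ $(i=1,\dots,r)$ with $a_i(s)\le a_{i+1}(s)$ for all $i=1,\dots,r-1$ and $s\ge0$, and for every constant $c>\frac{1}{1-\lambda}$, the function $\overline V:\mathbb{R}^n\times\mathbb{R}^{rm}\to\mathbb{R}_+$ defined by $$\overline V(z_r):=\sum_{i=0}^{r}c^i\,V(F_i(z_i))+\sum_{i=1}^{r}c^i a_i\big(|y_i-k(F_{i-1}(z_{i-1}))|\big)$$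 is a continuous, positive definite and radially unbounded function that satisfies $$\overline V\big(f(x,y_1),y_2,\dots,y_r,k(F_r(z_r))\big)\le(\lambda+c^{-1})\,\overline V(z_r)\quad\text{for all } z_r=(x,y_1,\dots,y_r)\in\mathbb{R}^n\times\mathbb{R}^{rm}.$$
   Context: $\mathbb{R}_+=[0,\infty)$ and $|\cdot|$ is the Euclidean norm. $K_\infty$ is the class of continuous, strictly increasing, unbounded functions $a:\mathbb{R}_+\to\mathbb{R}_+$ with $a(0)=0$. A function $W:\mathbb{R}^N\to\mathbb{R}_+$ is positive definite if $W(0)=0$ and $W(z)>0$ for $z\ne0$; it is radially unbounded if the sets $\{z:W(z)\le M\}$ are bounded for all $M\ge0$. Extended vectors: for $x\in\mathbb{R}^n$ and $y_1,\dots,y_{r}\in\mathbb{R}^m$, put $z_0=x$ and $z_i=(x,y_1,\dots,y_i)$ for $i=1,\dots,r$. The maps $F_i:\mathbb{R}^n\times\mathbb{R}^{im}\to\mathbb{R}^n$ are defined recursively by $F_0(x):=x$ and $F_{i+1}(z_{i+1}):=f(F_i(z_i),y_{i+1})$ for $i=0,\dots,r-1$. For a discrete-time system $z(t+1)=g(z(t))$ with $g(0)=0$, $t=0,1,2,\dots$, the equilibrium $0$ is globally asymptotically stable in the standard sense: it is Lyapunov stable and every solution converges to $0$ as $t\to\infty$. *)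

theory Defs
  imports "HOL-Analysis.Analysis"
begin

definition class_K_inf :: "(real \<Rightarrow> real) \<Rightarrow> bool" where
  "class_K_inf a \<longleftrightarrow>
     (\<forall>s\<ge>0. a s \<ge> 0) \<and> continuous_on {0..} a \<and> strict_mono_on {0..} a \<and>
     \<not> bdd_above (a ` {0..}) \<and> a 0 = 0"

definition pos_definite :: "('a::real_normed_vector \<Rightarrow> real) \<Rightarrow> bool" where
  "pos_definite W \<longleftrightarrow> W 0 = 0 \<and> (\<forall>z. z \<noteq> 0 \<longrightarrow> W z > 0)"

definition radially_unbounded :: "('a::real_normed_vector \<Rightarrow> real) \<Rightarrow> bool" where
  "radially_unbounded W \<longleftrightarrow> (\<forall>M\<ge>0. bounded {z. W z \<le> M})"

definition solution :: "('a \<Rightarrow> 'a) \<Rightarrow> (nat \<Rightarrow> 'a) \<Rightarrow> bool" where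
  "solution g z \<longleftrightarrow> (\<forall>t. z (Suc t) = g (z t))"

definition lyapunov_stable :: "('a::real_normed_vector \<Rightarrow> 'a) \<Rightarrow> bool" where
  "lyapunov_stable g \<longleftrightarrow>
     (\<forall>\<epsilon>>0. \<exists>\<delta>>0. \<forall>z. solution g z \<longrightarrow> norm (z 0) < \<delta> \<longrightarrow> (\<forall>t. norm (z t) < \<epsilon>))"

definition globally_asymptotically_stable :: "('a::real_normed_vector \<Rightarrow> 'a) \<Rightarrow> bool" where
  "globally_asymptotically_stable g \<longleftrightarrow>
     g 0 = 0 \<and> lyapunov_stable g \<and> (\<forall>z. solution g z \<longrightarrow> z \<longlonglongrightarrow> 0)"

text \<open>
  The map \<open>F\<^sub>i\<close>. The blocks are passed as a sequence \<open>y\<close> indexed from 1; only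
  \<open>y 1, \<dots>, y i\<close> are used, so \<open>predictor f i x y\<close> is \<open>F\<^sub>i(z\<^sub>i)\<close> with
  \<open>z\<^sub>i = (x, y\<^sub>1, \<dots>, y\<^sub>i)\<close>.
\<close>
primrec predictor ::
  "((real^'n) \<times> (real^'m) \<Rightarrow> real^'n) \<Rightarrow> nat \<Rightarrow> real^'n \<Rightarrow> (nat \<Rightarrow> real^'m) \<Rightarrow> real^'n" where
  "predictor f 0 x y = x"
| "predictor f (Suc i) x y = f (predictor f i x y, y (Suc i))"

text \<open>
  The space \<open>\<real>\<^sup>n \<times> \<real>\<^sup>r\<^sup>m\<close> is the type \<open>(real^'n) \<times> ((real^'m)^'r)\<close>, whose library norm is the
  Euclidean one. The block positions \<open>1, \<dots>, r\<close> are attached to the index type \<open>'r\<close> by an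
  enumeration \<open>e\<close>, assumed below to be a bijection from \<open>{1..r}\<close> onto \<open>'r\<close>: \<open>block e z i\<close>
  is \<open>y\<^sub>i\<close>, and \<open>stack e r x y\<close> is \<open>(x, y\<^sub>1, \<dots>, y\<^sub>r)\<close>.
\<close>
definition block :: "(nat \<Rightarrow> 'r) \<Rightarrow> (real^'n) \<times> ((real^'m)^'r) \<Rightarrow> nat \<Rightarrow> real^'m" where
  "block e z i = snd z $ e i"

definition stack ::
  "(nat \<Rightarrow> 'r) \<Rightarrow> nat \<Rightarrow> real^'n \<Rightarrow> (nat \<Rightarrow> real^'m) \<Rightarrow> (real^'n) \<times> ((real^'m)^'r)" where
  "stack e r x y = (x, \<chi> j. y (inv_into {1..r} e j))"

lemma block_stack:
  assumes "bij_betw e {1..r} UNIV" and "i \<in> {1..r}"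
  shows "block e (stack e r x y) i = y i"
  using assms by (simp add: block_def stack_def bij_betw_def)

definition closed_loop ::
  "(nat \<Rightarrow> 'r) \<Rightarrow> nat \<Rightarrow> ((real^'n) \<times> (real^'m) \<Rightarrow> real^'n) \<Rightarrow> (real^'n \<Rightarrow> real^'m) \<Rightarrow>
   (real^'n) \<times> ((real^'m)^'r) \<Rightarrow> (real^'n) \<times> ((real^'m)^'r)" where
  "closed_loop e r f k z =
     (let x = fst z; y = block e z
      in stack e r (f (x, y 1)) (\<lambda>i. if i < r then y (i + 1) else k (predictor f r x y)))"

definition Vbar ::
  "(nat \<Rightarrow> 'r) \<Rightarrow> nat \<Rightarrow> ((real^'n) \<times> (real^'m) \<Rightarrow> real^'n) \<Rightarrow> (real^'n \<Rightarrow> real^'m) \<Rightarrow>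
   (real^'n \<Rightarrow> real) \<Rightarrow> (nat \<Rightarrow> real \<Rightarrow> real) \<Rightarrow> real \<Rightarrow> (real^'n) \<times> ((real^'m)^'r) \<Rightarrow> real" where
  "Vbar e r f k V a c z =
     (let x = fst z; y = block e z
      in (\<Sum>i=0..r. c ^ i * V (predictor f i x y)) +
         (\<Sum>i=1..r. c ^ i * a i (norm (y i - k (predictor f (i - 1) x y)))))"

end

theory Submission
  imports Defs
begin

text \<open>
  Along the closed loop the predicted states form a queue: the new value of \<open>F\<^sub>i\<close> is the old value
  of \<open>F\<^sub>i\<^sub>+\<^sub>1\<close> for \<open>i < r\<close>, and the state that enters at the end is \<open>f (F\<^sub>r, k (F\<^sub>r))\<close>, one step of
  the delay-free closed loop. The input errors \<open>y\<^sub>i - k (F\<^sub>i\<^sub>-\<^sub>1)\<close> form a queue too, and the error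
  that enters at the end is zero because the new \<open>y\<^sub>r\<close> is exactly \<open>k (F\<^sub>r)\<close>
  (\<open>predictor_closed_loop\<close>, \<open>input_error_closed_loop\<close>). With the weights \<open>c\<^sup>i\<close> a shift by one place
  costs the factor \<open>1 / c\<close>, and the state entering at the end contributes at most \<open>lam\<close> times the
  last old term. This is the decrease of \<open>Vbar\<close> by the factor \<open>lam + 1 / c\<close>
  (\<open>weighted_shift_sum_le\<close>).

  The change of variables from the inputs \<open>y\<^sub>i\<close> to the errors is triangular, which gives the other
  properties of \<open>Vbar\<close>: if every \<open>V (F\<^sub>i)\<close> and every error is zero (or bounded), then \<open>x = F\<^sub>0\<close> and
  all \<open>y\<^sub>i\<close> are zero (or bounded). Asymptotic stability then follows by Lyapunov's direct method
  from \<open>Vbar\<close> with all gains equal to the identity, because \<open>c > 1 / (1 - lam)\<close> says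
  precisely that \<open>lam + 1 / c < 1\<close>.
\<close>

section \<open>Lyapunov functions with geometric decrease\<close>

lemma pos_definite_nonneg: "pos_definite W \<Longrightarrow> 0 \<le> W z"
  unfolding pos_definite_def by (cases "z = 0") (auto simp: less_imp_le)

text \<open>
  Radial unboundedness makes the part of a sublevel set outside the ball compact, so that \<open>W\<close> has a
  positive minimum there, and any smaller level serves as \<open>\<eta>\<close>.
\<close>
lemma sublevel_set_in_ball:
  fixes W :: "'a::{real_normed_vector, heine_borel} \<Rightarrow> real"
  assumes cont: "continuous_on UNIV W" and pd: "pos_definite W" and ru: "radially_unbounded W"
    and "\<epsilon> > 0"
  obtains \<eta> where "\<eta> > 0" "\<And>z. W z < \<eta> \<Longrightarrow> norm z < \<epsilon>"
proof -
  define K where "K = {z. W z \<le> 1} \<inter> {z. \<epsilon> \<le> norm z}"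
  have "closed K"
    unfolding K_def using cont
    by (intro closed_Int closed_Collect_le continuous_intros)
  moreover have "bounded K"
    using ru unfolding K_def radially_unbounded_def by (intro bounded_Int) auto
  ultimately have comp: "compact K"
    by (simp add: compact_eq_bounded_closed)
  show thesis
  proof (cases "K = {}")
    case True
    show thesis
    proof (rule that[of 1])
      fix z assume "W z < 1"
      then have "W z \<le> 1" by simp
      moreover have "z \<notin> K" using True by simp
      ultimately show "norm z < \<epsilon>" by (simp add: K_def)
    qed simp
  next
    case False
    obtain p where p: "p \<in> K" "\<And>z. z \<in> K \<Longrightarrow> W p \<le> W z"
      using continuous_attains_inf[OF comp False continuous_on_subset[OF cont]] by auto
    have "p \<noteq> 0" using p(1) \<open>\<epsilon> > 0\<close> by (auto simp: K_def)
    then have "W p > 0" using pd by (simp add: pos_definite_def)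
    show thesis
    proof (rule that[of "min 1 (W p)"])
      fix z assume "W z < min 1 (W p)"
      then have "W z \<le> 1" "z \<notin> K" using p(2)[of z] by auto
      then show "norm z < \<epsilon>" by (simp add: K_def)
    qed (use \<open>W p > 0\<close> in simp)
  qed
qed

text \<open>
  Along a solution \<open>W\<close> is at most \<open>q\<^sup>t\<close> times its initial value. This value is small near the
  origin by continuity, which gives stability, and the factor tends to zero, which gives
  convergence; the preceding lemma turns smallness of \<open>W\<close> into smallness of the state.
\<close>
lemma geometric_decrease_imp_globally_asymptotically_stable:
  fixes W :: "'a::{real_normed_vector, heine_borel} \<Rightarrow> real"
  assumes cont: "continuous_on UNIV W" and pd: "pos_definite W" and ru: "radially_unbounded W"
    and decr: "\<And>z. W (g z) \<le> q * W z" and q: "0 \<le> q" "q < 1"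
  shows "globally_asymptotically_stable g"
proof -
  have nonneg: "0 \<le> W z" for z
    using pd by (rule pos_definite_nonneg)
  have W0: "W 0 = 0"
    using pd by (simp add: pos_definite_def)
  have bound: "W (z t) \<le> q ^ t * W (z 0)" if "solution g z" for z t
  proof (induction t)
    case (Suc t)
    have "W (z (Suc t)) \<le> q * W (z t)"
      using that decr by (simp add: solution_def)
    also have "\<dots> \<le> q * (q ^ t * W (z 0))"
      using Suc q by (intro mult_left_mono) auto
    finally show ?case by (simp add: mult.assoc)
  qed simp
  have "W (g 0) \<le> 0"
    using decr[of 0] W0 by simp
  then have "g 0 = 0"
    using pd unfolding pos_definite_def by fastforce
  moreover have "lyapunov_stable g"
    unfolding lyapunov_stable_def
  proof (intro allI impI)
    fix \<epsilon> :: real assume "\<epsilon> > 0"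
    then obtain \<eta> where \<eta>: "\<eta> > 0" "\<And>z. W z < \<eta> \<Longrightarrow> norm z < \<epsilon>"
      using sublevel_set_in_ball[OF cont pd ru] by blast
    obtain \<delta> where \<delta>: "\<delta> > 0" "\<And>z. dist z 0 < \<delta> \<Longrightarrow> dist (W z) (W 0) < \<eta>"
      using cont \<open>\<eta> > 0\<close> unfolding continuous_on_iff by (metis UNIV_I)
    show "\<exists>\<delta>>0. \<forall>z. solution g z \<longrightarrow> norm (z 0) < \<delta> \<longrightarrow> (\<forall>t. norm (z t) < \<epsilon>)"
    proof (intro exI[of _ \<delta>] conjI allI impI)
      fix z t assume z: "solution g z" "norm (z 0) < \<delta>"
      have "W (z t) \<le> q ^ t * W (z 0)"
        using z(1) by (rule bound)
      also have "\<dots> \<le> 1 * W (z 0)"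
        using q nonneg by (intro mult_right_mono power_le_one) auto
      also have "\<dots> < \<eta>"
        using \<delta>(2)[of "z 0"] z(2) W0 by (simp add: dist_real_def)
      finally show "norm (z t) < \<epsilon>" by (rule \<eta>(2))
    qed (rule \<delta>(1))
  qed
  moreover have "z \<longlonglongrightarrow> 0" if z: "solution g z" for z
  proof (rule tendstoI)
    fix \<epsilon> :: real assume "\<epsilon> > 0"
    then obtain \<eta> where \<eta>: "\<eta> > 0" "\<And>z. W z < \<eta> \<Longrightarrow> norm z < \<epsilon>"
      using sublevel_set_in_ball[OF cont pd ru] by blast
    have "(\<lambda>t. q ^ t * W (z 0)) \<longlonglongrightarrow> 0"
      using q by (intro tendsto_mult_left_zero LIMSEQ_power_zero) auto
    then have "\<forall>\<^sub>F t in sequentially. q ^ t * W (z 0) < \<eta>"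
      using \<eta>(1) by (rule order_tendstoD)
    then show "\<forall>\<^sub>F t in sequentially. dist (z t) 0 < \<epsilon>"
      by eventually_elim (use \<eta>(2)[OF le_less_trans[OF bound[OF z]]] in simp)
  qed
  ultimately show ?thesis
    by (simp add: globally_asymptotically_stable_def)
qed

section \<open>Geometrically weighted sums over a queue\<close>

text \<open>
  For \<open>i < r\<close> the term \<open>c\<^sup>i u' i\<close> is at most \<open>1 / c\<close> times the term with index \<open>i + 1\<close> of the old
  sum; the last term is at most \<open>lam\<close> times its old value. Adding the two estimates counts the
  last old term twice, hence the sum of the two factors.
\<close>
lemma weighted_shift_sum_le:
  fixes u u' :: "nat \<Rightarrow> real" and c lam :: real
  assumes "m \<le> r" "c > 0" "lam \<ge> 0"
    and nonneg: "\<And>i. i \<in> {m..r} \<Longrightarrow> 0 \<le> u i"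
    and shift: "\<And>i. i \<in> {m..<r} \<Longrightarrow> u' i \<le> u (Suc i)"
    and last: "u' r \<le> lam * u r"
  shows "(\<Sum>i=m..r. c ^ i * u' i) \<le> (lam + 1 / c) * (\<Sum>i=m..r. c ^ i * u i)"
proof -
  let ?S = "\<Sum>i=m..r. c ^ i * u i"
  have "(\<Sum>i=m..<r. c ^ i * u' i) \<le> (\<Sum>i=m..<r. c ^ i * u (Suc i))"
    using shift \<open>c > 0\<close> by (intro sum_mono mult_left_mono) auto
  also have "\<dots> = (1 / c) * (\<Sum>i=m..<r. c ^ Suc i * u (Suc i))"
    using \<open>c > 0\<close> by (simp add: sum_distrib_left)
  also have "(\<Sum>i=m..<r. c ^ Suc i * u (Suc i)) = (\<Sum>i=Suc m..r. c ^ i * u i)"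
    unfolding atLeastLessThanSuc_atLeastAtMost[symmetric]
    by (rule sum.shift_bounds_Suc_ivl[symmetric])
  also have "(1 / c) * \<dots> \<le> (1 / c) * ?S"
    using nonneg \<open>c > 0\<close> by (intro mult_left_mono sum_mono2) auto
  finally have front: "(\<Sum>i=m..<r. c ^ i * u' i) \<le> (1 / c) * ?S" .
  have "c ^ r * u' r \<le> lam * (c ^ r * u r)"
    using mult_left_mono[OF last, of "c ^ r"] \<open>c > 0\<close> by (simp add: mult_ac)
  also have "\<dots> \<le> lam * ?S"
    using nonneg assms(1-3)
    by (intro mult_left_mono member_le_sum[where f = "\<lambda>i. c ^ i * u i"]) auto
  finally have end_term: "c ^ r * u' r \<le> lam * ?S" .
  have "(\<Sum>i=m..r. c ^ i * u' i) = (\<Sum>i=m..<r. c ^ i * u' i) + c ^ r * u' r"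
    using \<open>m \<le> r\<close> by (simp add: sum.last_plus)
  then show ?thesis
    using front end_term by (simp add: algebra_simps)
qed

section \<open>Gains of class K-infinity\<close>

lemma class_K_inf_nonneg: "class_K_inf a \<Longrightarrow> 0 \<le> s \<Longrightarrow> 0 \<le> a s"
  by (simp add: class_K_inf_def)

lemma class_K_inf_eq_0_iff:
  assumes "class_K_inf a" "0 \<le> s"
  shows "a s = 0 \<longleftrightarrow> s = 0"
proof -
  have "strict_mono_on {0..} a" "a 0 = 0"
    using assms(1) by (auto simp: class_K_inf_def)
  then have "0 < a s" if "0 < s"
    using that strict_mono_onD[of "{0..}" a 0 s] by simp
  then show ?thesis
    using assms(2) \<open>a 0 = 0\<close> by force
qed

lemma class_K_inf_le_imp_bounded:
  assumes "class_K_inf a"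
  obtains B where "\<And>s. 0 \<le> s \<Longrightarrow> a s \<le> M \<Longrightarrow> s \<le> B"
proof -
  have "\<not> bdd_above (a ` {0..})"
    using assms by (simp add: class_K_inf_def)
  then obtain B where B: "0 \<le> B" "M < a B"
    unfolding bdd_above_def by (auto simp: not_le)
  have "strict_mono_on {0..} a"
    using assms by (simp add: class_K_inf_def)
  then have mono: "a B < a s" if "B < s" for s
    using that B(1) by (simp add: strict_mono_onD)
  show thesis
  proof (rule that[of B])
    fix s assume "a s \<le> M"
    then show "s \<le> B"
      using mono[of s] B(2) by linarith
  qed
qed

lemma class_K_inf_id: "class_K_inf (\<lambda>s. s)"
proof -
  have "\<not> bdd_above {0::real..}"
    by (metis (no_types) atLeast_iff bdd_above_def gt_ex leD le_less_linear less_imp_le order_trans)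
  then show ?thesis
    by (simp add: class_K_inf_def strict_mono_on_def)
qed

section \<open>Predictors along the closed loop\<close>

abbreviation pred_state ::
  "(nat \<Rightarrow> 'r) \<Rightarrow> ((real^'n) \<times> (real^'m) \<Rightarrow> real^'n) \<Rightarrow> (real^'n) \<times> ((real^'m)^'r) \<Rightarrow> nat \<Rightarrow> real^'n"
where
  "pred_state e f z i \<equiv> predictor f i (fst z) (block e z)"

abbreviation input_error ::
  "(nat \<Rightarrow> 'r) \<Rightarrow> ((real^'n) \<times> (real^'m) \<Rightarrow> real^'n) \<Rightarrow> (real^'n \<Rightarrow> real^'m) \<Rightarrow>
   (real^'n) \<times> ((real^'m)^'r) \<Rightarrow> nat \<Rightarrow> real^'m"
where
  "input_error e f k z i \<equiv> block e z i - k (pred_state e f z (i - 1))"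

lemma Vbar_eq:
  "Vbar e r f k V a c z =
    (\<Sum>i=0..r. c ^ i * V (pred_state e f z i)) +
    (\<Sum>i=1..r. c ^ i * a i (norm (input_error e f k z i)))"
  by (simp add: Vbar_def Let_def)

lemma fst_closed_loop: "fst (closed_loop e r f k z) = f (fst z, block e z 1)"
  by (simp add: closed_loop_def Let_def stack_def)

lemma block_closed_loop:
  assumes "bij_betw e {1..r} UNIV" "i \<in> {1..r}"
  shows "block e (closed_loop e r f k z) i =
    (if i < r then block e z (Suc i) else k (pred_state e f z r))"
  using assms by (simp add: closed_loop_def Let_def block_stack)

lemma predictor_closed_loop:
  assumes e: "bij_betw e {1..r} UNIV" and "1 \<le> r" and "i \<le> r"
  shows "pred_state e f (closed_loop e r f k z) i =
    (if i < r then pred_state e f z (Suc i)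
     else f (pred_state e f z r, k (pred_state e f z r)))"
  using \<open>i \<le> r\<close>
proof (induction i)
  case 0
  then show ?case
    using \<open>1 \<le> r\<close> by (simp add: fst_closed_loop)
next
  case (Suc i)
  then show ?case
    using block_closed_loop[OF e, of "Suc i" f k z]
    by (cases "Suc i < r") auto
qed

lemma input_error_closed_loop:
  assumes e: "bij_betw e {1..r} UNIV" and i: "i \<in> {1..r}"
  shows "input_error e f k (closed_loop e r f k z) i =
    (if i < r then input_error e f k z (Suc i) else 0)"
proof -
  have "Suc (i - 1) = i" "i - 1 < r" "1 \<le> r"
    using i by auto
  then have "pred_state e f (closed_loop e r f k z) (i - 1) = pred_state e f z i"
    using predictor_closed_loop[OF e, of "i - 1" f k z] by simp
  then show ?thesis
    using block_closed_loop[OF e i, of f k z] i by auto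
qed

lemma continuous_on_block:
  "continuous_on UNIV (\<lambda>z :: (real^'n) \<times> ((real^'m)^'r::finite). block e z i)"
  unfolding block_def by (intro continuous_intros)

lemma continuous_on_pred_state:
  fixes e :: "nat \<Rightarrow> 'r::finite"
  assumes "continuous_on UNIV f"
  shows "continuous_on UNIV (\<lambda>z. pred_state e f z i)"
proof (induction i)
  case 0
  show ?case by (simp add: continuous_on_fst)
next
  case (Suc i)
  then show ?case
    unfolding predictor.simps
    by (intro continuous_on_compose2[OF assms] continuous_intros continuous_on_block) auto
qed

section \<open>The Lyapunov function of the delayed closed loop\<close>

lemma continuous_on_Vbar:
  fixes e :: "nat \<Rightarrow> 'r::finite"
  assumes f: "continuous_on UNIV f" and k: "continuous_on UNIV k" and V: "continuous_on UNIV V"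
    and a: "\<forall>i\<in>{1..r}. class_K_inf (a i)"
  shows "continuous_on UNIV (Vbar e r f k V a c)"
proof -
  have "continuous_on UNIV (\<lambda>z. V (pred_state e f z i))" for i
    by (rule continuous_on_compose2[OF V continuous_on_pred_state[OF f]]) simp
  moreover have "continuous_on UNIV (\<lambda>z. a i (norm (input_error e f k z i)))"
    if "i \<in> {1..r}" for i
  proof -
    have "continuous_on UNIV (\<lambda>z. k (pred_state e f z (i - 1)))"
      by (rule continuous_on_compose2[OF k continuous_on_pred_state[OF f]]) simp
    then have "continuous_on UNIV (\<lambda>z. norm (input_error e f k z i))"
      by (intro continuous_intros continuous_on_block)
    moreover have "continuous_on {0..} (a i)"
      using a that by (simp add: class_K_inf_def)
    ultimately show ?thesis
      using continuous_on_compose2[where f = "\<lambda>z. norm (input_error e f k z i)"] by fastforce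
  qed
  ultimately show ?thesis
    unfolding Vbar_eq[abs_def] by (intro continuous_intros)
qed

text \<open>
  All terms of \<open>Vbar\<close> are nonnegative and all weights are at least 1, so \<open>Vbar\<close> dominates every
  unweighted term. Definiteness and radial unboundedness both reduce to this.
\<close>
lemma terms_le_Vbar:
  assumes V: "\<And>x. 0 \<le> V x" and a: "\<forall>i\<in>{1..r}. class_K_inf (a i)" and c: "1 \<le> c"
  shows "i \<le> r \<Longrightarrow> V (pred_state e f z i) \<le> Vbar e r f k V a c z"
    and "i \<in> {1..r} \<Longrightarrow> a i (norm (input_error e f k z i)) \<le> Vbar e r f k V a c z"
proof -
  let ?S = "\<Sum>i=0..r. c ^ i * V (pred_state e f z i)"
  let ?E = "\<Sum>i=1..r. c ^ i * a i (norm (input_error e f k z i))"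
  have S: "0 \<le> c ^ i * V (pred_state e f z i)" for i
    using c V by simp
  have A: "0 \<le> a i (norm (input_error e f k z i))" if "i \<in> {1..r}" for i
    using a that by (simp add: class_K_inf_nonneg)
  have E: "0 \<le> c ^ i * a i (norm (input_error e f k z i))" if "i \<in> {1..r}" for i
    using A[OF that] c by simp
  have weight: "t \<le> c ^ i * t" if "0 \<le> t" for t :: real and i
    using mult_right_mono[OF one_le_power[OF c, of i] that] by simp
  have "0 \<le> ?S" "0 \<le> ?E"
    using S E by (auto intro!: sum_nonneg)
  show "V (pred_state e f z i) \<le> Vbar e r f k V a c z" if "i \<le> r"
  proof -
    have "c ^ i * V (pred_state e f z i) \<le> ?S"
      using that S by (intro member_le_sum[where f = "\<lambda>i. c ^ i * V (pred_state e f z i)"]) auto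
    then show ?thesis
      using weight[OF V[of "pred_state e f z i"], of i] \<open>0 \<le> ?E\<close> unfolding Vbar_eq by linarith
  qed
  show "a i (norm (input_error e f k z i)) \<le> Vbar e r f k V a c z" if "i \<in> {1..r}"
  proof -
    have "c ^ i * a i (norm (input_error e f k z i)) \<le> ?E"
      using that E
      by (intro member_le_sum[where f = "\<lambda>i. c ^ i * a i (norm (input_error e f k z i))"]) auto
    then show ?thesis
      using weight[OF A[OF that], of i] \<open>0 \<le> ?S\<close> unfolding Vbar_eq by linarith
  qed
qed

lemma block_zero: "block e 0 i = 0"
  by (simp add: block_def)

lemma predictor_zero:
  assumes "f (0, 0) = 0"
  shows "predictor f i 0 (block e 0) = 0"
  by (induction i) (simp_all add: assms block_zero)

lemma pos_definite_Vbar: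
  fixes f :: "(real^'n) \<times> (real^'m) \<Rightarrow> real^'n" and e :: "nat \<Rightarrow> 'r::finite"
  assumes e: "bij_betw e {1..r} UNIV" and f0: "f (0, 0) = 0" and k0: "k 0 = 0"
    and V: "pos_definite V" and a: "\<forall>i\<in>{1..r}. class_K_inf (a i)" and c: "1 \<le> c"
  shows "pos_definite (Vbar e r f k V a c)"
  unfolding pos_definite_def
proof (intro conjI allI impI)
  have "V 0 = 0"
    using V by (simp add: pos_definite_def)
  then show "Vbar e r f k V a c 0 = 0"
    using a k0 by (simp add: Vbar_eq predictor_zero[where f = f, OF f0] block_zero class_K_inf_def)
next
  fix z :: "(real^'n) \<times> ((real^'m)^'r)"
  assume "z \<noteq> 0"
  have V_nonneg: "0 \<le> V x" for x
    using V by (rule pos_definite_nonneg)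
  note le = terms_le_Vbar[where e = e and f = f and k = k and z = z and V = V, OF V_nonneg a c]
  show "0 < Vbar e r f k V a c z"
  proof (rule ccontr)
    assume "\<not> ?thesis"
    then have nonpos: "Vbar e r f k V a c z \<le> 0" by simp
    have P0: "pred_state e f z i = 0" if "i \<le> r" for i
      using order_trans[OF le(1)[OF that] nonpos] V unfolding pos_definite_def by fastforce
    have "block e z i = 0" if i: "i \<in> {1..r}" for i
    proof -
      have K: "class_K_inf (a i)" using a i by blast
      have "a i (norm (input_error e f k z i)) = 0"
      proof (rule order_antisym)
        show "a i (norm (input_error e f k z i)) \<le> 0"
          using le(2)[OF i] nonpos by linarith
        show "0 \<le> a i (norm (input_error e f k z i))"
          using K norm_ge_zero by (rule class_K_inf_nonneg)
      qed
      then have "input_error e f k z i = 0"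
        by (simp only: class_K_inf_eq_0_iff[OF K norm_ge_zero] norm_eq_zero)
      then show ?thesis
        using P0[of "i - 1"] i k0 by auto
    qed
    then have "snd z $ j = 0" for j
      using e unfolding bij_betw_def block_def by (metis UNIV_I imageE)
    then have "snd z = 0"
      by (simp add: vec_eq_iff)
    moreover have "fst z = 0"
      using P0[of 0] by simp
    ultimately show False
      using \<open>z \<noteq> 0\<close> by (simp add: prod_eq_iff)
  qed
qed

text \<open>
  On a sublevel set every \<open>F\<^sub>i\<close> stays in a sublevel set of \<open>V\<close>, where \<open>k\<close> is bounded by
  compactness; hence \<open>y\<^sub>i\<close>, which is \<open>k (F\<^sub>i\<^sub>-\<^sub>1)\<close> plus a bounded error, is bounded as well.
\<close>
lemma radially_unbounded_Vbar:
  fixes e :: "nat \<Rightarrow> 'r::finite"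
  assumes e: "bij_betw e {1..r} UNIV" and k: "continuous_on UNIV k"
    and V_nonneg: "\<And>x. 0 \<le> V x" and V: "radially_unbounded V"
    and a: "\<forall>i\<in>{1..r}. class_K_inf (a i)" and c: "1 \<le> c"
  shows "radially_unbounded (Vbar e r f k V a c)"
  unfolding radially_unbounded_def
proof (intro allI impI)
  fix M :: real assume "M \<ge> 0"
  let ?L = "{z. Vbar e r f k V a c z \<le> M}"
  note le = terms_le_Vbar[where e = e and f = f and k = k and V = V, OF V_nonneg a c]
  have bV: "bounded {x. V x \<le> M}"
    using V \<open>M \<ge> 0\<close> by (simp add: radially_unbounded_def)
  have "compact (k ` closure {x. V x \<le> M})"
    using bV k by (intro compact_continuous_image) (auto intro: continuous_on_subset)
  then have "bounded (k ` closure {x. V x \<le> M})"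
    by (rule compact_imp_bounded)
  then obtain C where C: "\<And>x. V x \<le> M \<Longrightarrow> norm (k x) \<le> C"
    unfolding bounded_iff using closure_subset[of "{x. V x \<le> M}"] by blast
  have bounded_block: "bounded ((\<lambda>z. block e z i) ` ?L)" if i: "i \<in> {1..r}" for i
  proof -
    obtain B where B: "\<And>s. 0 \<le> s \<Longrightarrow> a i s \<le> M \<Longrightarrow> s \<le> B"
      using class_K_inf_le_imp_bounded a i by blast
    have "norm (block e z i) \<le> B + C" if "z \<in> ?L" for z
    proof -
      have "norm (input_error e f k z i) \<le> B"
        using le(2)[OF i, of z] that by (intro B) auto
      moreover have "norm (k (pred_state e f z (i - 1))) \<le> C"
        using order_trans[OF le(1)[of "i - 1" z]] that i by (intro C) auto
      ultimately show ?thesis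
        using norm_triangle_ineq[of "input_error e f k z i" "k (pred_state e f z (i - 1))"] by simp
    qed
    then show ?thesis
      unfolding bounded_iff by blast
  qed
  have "bounded ((\<lambda>v. v $ j) ` (snd ` ?L))" for j
  proof -
    obtain i where "i \<in> {1..r}" "e i = j"
      using e unfolding bij_betw_def by (metis UNIV_I imageE)
    then show ?thesis
      using bounded_block[of i] by (simp add: block_def image_image)
  qed
  then have "\<forall>j. \<exists>D. \<forall>v\<in>snd ` ?L. norm (v $ j) \<le> D"
    unfolding bounded_iff by blast
  then obtain D where D: "\<And>j v. v \<in> snd ` ?L \<Longrightarrow> norm (v $ j) \<le> D j"
    by metis
  have "norm v \<le> (\<Sum>j\<in>UNIV. D j)" if "v \<in> snd ` ?L" for v
  proof -
    have "norm v \<le> (\<Sum>j\<in>UNIV. norm (v $ j))"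
      unfolding norm_vec_def by (rule L2_set_le_sum) simp
    also have "\<dots> \<le> (\<Sum>j\<in>UNIV. D j)"
      using D[OF that] by (rule sum_mono)
    finally show ?thesis .
  qed
  then have "bounded (snd ` ?L)"
    unfolding bounded_iff by blast
  moreover have "bounded (fst ` ?L)"
    using order_trans[OF le(1)[of 0]] by (intro bounded_subset[OF bV]) auto
  ultimately show "bounded ?L"
    by (rule bounded_subset[OF bounded_Times[rotated]]) (auto intro: rev_image_eqI)
qed

text \<open>
  The two sums of \<open>Vbar\<close> are queues to which the shift estimate applies separately. In the second
  one, an error that moves from place \<open>i + 1\<close> to place \<open>i\<close> is afterwards measured with \<open>a\<^sub>i\<close> instead
  of \<open>a\<^sub>i\<^sub>+\<^sub>1\<close>, so the gains must not decrease with the index.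
\<close>
lemma Vbar_closed_loop_le:
  fixes e :: "nat \<Rightarrow> 'r::finite"
  assumes e: "bij_betw e {1..r} UNIV" and "1 \<le> r"
    and V_nonneg: "\<And>x. 0 \<le> V x" and V_decr: "\<And>x. V (f (x, k x)) \<le> lam * V x" and "0 \<le> lam"
    and a: "\<forall>i\<in>{1..r}. class_K_inf (a i)"
    and a_mono: "\<forall>i\<in>{1..r-1}. \<forall>s\<ge>0. a i s \<le> a (i + 1) s" and "0 < c"
  shows "Vbar e r f k V a c (closed_loop e r f k z) \<le> (lam + 1 / c) * Vbar e r f k V a c z"
proof -
  let ?z' = "closed_loop e r f k z"
  have "(\<Sum>i=0..r. c ^ i * V (pred_state e f ?z' i)) \<le>
      (lam + 1 / c) * (\<Sum>i=0..r. c ^ i * V (pred_state e f z i))"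
    using \<open>0 < c\<close> \<open>0 \<le> lam\<close> V_nonneg V_decr
    by (intro weighted_shift_sum_le) (simp_all add: predictor_closed_loop[OF e \<open>1 \<le> r\<close>] del: predictor.simps)
  moreover have "(\<Sum>i=1..r. c ^ i * a i (norm (input_error e f k ?z' i))) \<le>
      (lam + 1 / c) * (\<Sum>i=1..r. c ^ i * a i (norm (input_error e f k z i)))"
  proof (rule weighted_shift_sum_le)
    show nonneg: "0 \<le> a i (norm (input_error e f k z i))" if "i \<in> {1..r}" for i
      using a that by (simp add: class_K_inf_nonneg)
    show "a i (norm (input_error e f k ?z' i)) \<le> a (Suc i) (norm (input_error e f k z (Suc i)))"
      if "i \<in> {1..<r}" for i
    proof -
      have "i \<in> {1..r}" "i \<in> {1..r-1}" "i < r"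
        using that by auto
      then show ?thesis
        using a_mono unfolding input_error_closed_loop[OF e \<open>i \<in> {1..r}\<close>] by simp
    qed
    have r: "r \<in> {1..r}" using \<open>1 \<le> r\<close> by simp
    have "a r (norm (input_error e f k ?z' r)) = 0"
      using a r unfolding input_error_closed_loop[OF e r] by (simp add: class_K_inf_def)
    then show "a r (norm (input_error e f k ?z' r)) \<le> lam * a r (norm (input_error e f k z r))"
      using nonneg[OF r] \<open>0 \<le> lam\<close> by simp
  qed (use \<open>1 \<le> r\<close> \<open>0 < c\<close> \<open>0 \<le> lam\<close> in auto)
  ultimately show ?thesis
    unfolding Vbar_eq distrib_left by (rule add_mono)
qed

theorem lemma2p2:
  fixes f :: "(real^'n) \<times> (real^'m) \<Rightarrow> real^'n"
    and k :: "real^'n \<Rightarrow> real^'m"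
    and V :: "real^'n \<Rightarrow> real"
    and lam :: real
    and r :: nat
    and e :: "nat \<Rightarrow> 'r::finite"
  assumes r: "r \<ge> 2"
    and e: "bij_betw e {1..r} (UNIV :: 'r set)"
    and f_cont: "continuous_on UNIV f"
    and f_zero: "f (0, 0) = 0"
    and k_cont: "continuous_on UNIV k"
    and k_zero: "k 0 = 0"
    and gas: "globally_asymptotically_stable (\<lambda>x. f (x, k x))"
    and V_cont: "continuous_on UNIV V"
    and V_pd: "pos_definite V"
    and V_ru: "radially_unbounded V"
    and lam: "lam \<in> {0..<1}"
    and V_decr: "\<forall>x. V (f (x, k x)) \<le> lam * V x"
  shows "globally_asymptotically_stable (closed_loop e r f k) \<and>
    (\<forall>a c. (\<forall>i\<in>{1..r}. class_K_inf (a i)) \<longrightarrow>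
       (\<forall>i\<in>{1..r-1}. \<forall>s\<ge>0. a i s \<le> a (i + 1) s) \<longrightarrow>
       c > 1 / (1 - lam) \<longrightarrow>
         continuous_on UNIV (Vbar e r f k V a c) \<and>
         pos_definite (Vbar e r f k V a c) \<and>
         radially_unbounded (Vbar e r f k V a c) \<and>
         (\<forall>z. Vbar e r f k V a c (closed_loop e r f k z) \<le> (lam + 1 / c) * Vbar e r f k V a c z))"
proof -
  have V_nonneg: "0 \<le> V x" for x
    using V_pd by (rule pos_definite_nonneg)
  have lam01: "0 \<le> lam" "lam < 1"
    using lam by auto
  have c_ge_1: "1 \<le> c" and rate: "lam + 1 / c < 1" if c: "c > 1 / (1 - lam)" for c :: real
  proof -
    have "1 \<le> 1 / (1 - lam)"
      using lam01 by simp
    then show "1 \<le> c"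
      using c by linarith
    then show "lam + 1 / c < 1"
      using c lam01 by (simp add: field_simps)
  qed
  have Vbar_properties: "continuous_on UNIV (Vbar e r f k V a c) \<and>
         pos_definite (Vbar e r f k V a c) \<and>
         radially_unbounded (Vbar e r f k V a c) \<and>
         (\<forall>z. Vbar e r f k V a c (closed_loop e r f k z) \<le> (lam + 1 / c) * Vbar e r f k V a c z)"
    if a: "\<forall>i\<in>{1..r}. class_K_inf (a i)"
      and mono: "\<forall>i\<in>{1..r-1}. \<forall>s\<ge>0. a i s \<le> a (i + 1) s"
      and c: "c > 1 / (1 - lam)" for a c
  proof (intro conjI allI)
    show "continuous_on UNIV (Vbar e r f k V a c)"
      by (rule continuous_on_Vbar[OF f_cont k_cont V_cont a])
    show "pos_definite (Vbar e r f k V a c)"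
      using e f_zero k_zero V_pd a c_ge_1[OF c] by (rule pos_definite_Vbar)
    show "radially_unbounded (Vbar e r f k V a c)"
      using e k_cont V_nonneg V_ru a c_ge_1[OF c] by (rule radially_unbounded_Vbar)
    show "Vbar e r f k V a c (closed_loop e r f k z) \<le> (lam + 1 / c) * Vbar e r f k V a c z" for z
      using r V_decr lam01(1) c_ge_1[OF c]
      by (intro Vbar_closed_loop_le[OF e _ V_nonneg _ _ a mono]) auto
  qed
  define c where "c = 1 / (1 - lam) + 1"
  have c: "c > 1 / (1 - lam)"
    by (simp add: c_def)
  have W: "continuous_on UNIV (Vbar e r f k V (\<lambda>_ s. s) c)"
    "pos_definite (Vbar e r f k V (\<lambda>_ s. s) c)"
    "radially_unbounded (Vbar e r f k V (\<lambda>_ s. s) c)"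
    "Vbar e r f k V (\<lambda>_ s. s) c (closed_loop e r f k z) \<le>
      (lam + 1 / c) * Vbar e r f k V (\<lambda>_ s. s) c z" for z
    using Vbar_properties[of "\<lambda>_ s. s" c] c
    by (simp_all add: class_K_inf_id del: split_paired_All)
  have "0 \<le> lam + 1 / c"
    using lam01 c_ge_1[OF c] by simp
  then have stable: "globally_asymptotically_stable (closed_loop e r f k)"
    using geometric_decrease_imp_globally_asymptotically_stable
      [where W = "Vbar e r f k V (\<lambda>_ s. s) c" and g = "closed_loop e r f k" and q = "lam + 1 / c"]
      W rate[OF c] by blast
  show ?thesis
    by (rule conjI[OF stable], intro allI impI) (rule Vbar_properties)
qed

end
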